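(* Let $\Omega$ be sampled according to the Bernoulli model with $p=m/(n_1n_2)$ and put $n=\max(n_1,n_2)$. Suppose $\max(\mu(U),\mu(V))\le\mu_0$. Then there is a numerical constant $C_R$ such that for all $\beta>1$, $$p^{-1}\,\|\mathcal{P}_T\mathcal{P}_\Omega\mathcal{P}_T-p\,\mathcal{P}_T\|\le C_R\sqrt{\frac{\mu_0\,n r\,(\beta\log n)}{m}}$$ with probability at least $1-3n^{-\beta}$, provided that $C_R\sqrt{\mu_0 nr(\beta\log n)/m}<1$.
   Context: Setup: $U\subseteq\mathbb{R}^{n_1}$, $V\subseteq\mathbb{R}^{n_2}$ are $r$-dimensional subspaces (column and row spaces of a rank-$r$ matrix $M=\sum_{k=1}^r\sigma_ku_kv_k^*$) with orthogonal projections $P_U,P_V$. Coherence: for an $r$-dimensional subspace $W\subseteq\mathbb{R}^d$, $\mu(W)=\frac dr\max_{1\le i\le d}\|P_We_i\|^2$. $T$ is the subspace of $\mathbb{R}^{n_1\times n_2}$ spanned by matrices $u_kx^*$ and $yv_k^*$; $\mathcal{P}_T(X)=P_UX+XP_V-P_UXP_V$. Bernoulli model: $\{\delta_{ab}\}$ are i.i.d. $0/1$ variables with $\mathbb{P}(\delta_{ab}=1)=p$, $\Omega=\{(a,b):\delta_{ab}=1\}$, and $\mathcal{P}_\Omega(X)$ keeps the entries of $X$ in $\Omega$ and sets the others to zero. For a linear map $\mathcal{A}$ on $\mathbb{R}^{n_1\times n_2}$, $\|\mathcal{A}\|=\sup_{\|X\|_F\le1}\|\mathcal{A}(X)\|_F$.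 *)

theory Defs
  imports "HOL-Probability.Probability"
begin

text \<open>Explicit-carrier representation: a vector of R^d is a function nat => real read on
  indices < d; an n1 x n2 matrix is a function nat => nat => real read on {..<n1} x {..<n2}.\<close>

definition orthonormal_family :: "nat \<Rightarrow> nat \<Rightarrow> (nat \<Rightarrow> nat \<Rightarrow> real) \<Rightarrow> bool" where
  "orthonormal_family d r u \<longleftrightarrow>
     (\<forall>k<r. \<forall>l<r. (\<Sum>i<d. u k i * u l i) = (if k = l then 1 else 0))"

text \<open>Orthogonal projection onto span of the orthonormal family u_0..u_(r-1), as a d x d matrix.\<close>
definition proj_mat :: "nat \<Rightarrow> (nat \<Rightarrow> nat \<Rightarrow> real) \<Rightarrow> nat \<Rightarrow> nat \<Rightarrow> real" where
  "proj_mat r u i j = (\<Sum>k<r. u k i * u k j)"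

definition coherence :: "nat \<Rightarrow> nat \<Rightarrow> (nat \<Rightarrow> nat \<Rightarrow> real) \<Rightarrow> real" where
  "coherence d r u = real d / real r *
     Max ((\<lambda>i. (\<Sum>j<d. (proj_mat r u j i)\<^sup>2)) ` {..<d})"

definition mat_mult :: "nat \<Rightarrow> (nat \<Rightarrow> nat \<Rightarrow> real) \<Rightarrow> (nat \<Rightarrow> nat \<Rightarrow> real) \<Rightarrow> nat \<Rightarrow> nat \<Rightarrow> real" where
  "mat_mult q A B i j = (\<Sum>l<q. A i l * B l j)"

definition frob :: "nat \<Rightarrow> nat \<Rightarrow> (nat \<Rightarrow> nat \<Rightarrow> real) \<Rightarrow> real" where
  "frob n1 n2 X = sqrt (\<Sum>a<n1. \<Sum>b<n2. (X a b)\<^sup>2)"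

definition P_T :: "nat \<Rightarrow> nat \<Rightarrow> nat \<Rightarrow> (nat \<Rightarrow> nat \<Rightarrow> real) \<Rightarrow> (nat \<Rightarrow> nat \<Rightarrow> real)
    \<Rightarrow> (nat \<Rightarrow> nat \<Rightarrow> real) \<Rightarrow> (nat \<Rightarrow> nat \<Rightarrow> real)" where
  "P_T n1 n2 r u v X = (\<lambda>a b.
     mat_mult n1 (proj_mat r u) X a b + mat_mult n2 X (proj_mat r v) a b
     - mat_mult n2 (mat_mult n1 (proj_mat r u) X) (proj_mat r v) a b)"

definition P_Omega :: "(nat \<times> nat \<Rightarrow> bool) \<Rightarrow> (nat \<Rightarrow> nat \<Rightarrow> real) \<Rightarrow> (nat \<Rightarrow> nat \<Rightarrow> real)" where
  "P_Omega \<delta> X = (\<lambda>a b. if \<delta> (a, b) then X a b else 0)"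

definition op_norm :: "nat \<Rightarrow> nat \<Rightarrow> ((nat \<Rightarrow> nat \<Rightarrow> real) \<Rightarrow> (nat \<Rightarrow> nat \<Rightarrow> real)) \<Rightarrow> real" where
  "op_norm n1 n2 A = Sup {frob n1 n2 (A X) | X. frob n1 n2 X \<le> 1}"

definition bernoulli_model :: "nat \<Rightarrow> nat \<Rightarrow> real \<Rightarrow> (nat \<times> nat \<Rightarrow> bool) pmf" where
  "bernoulli_model n1 n2 p = Pi_pmf ({..<n1} \<times> {..<n2}) False (\<lambda>_. bernoulli_pmf p)"

end

theory Submission
  imports Defs
begin

text \<open>Trace-moment argument avoiding matrix exponentials and the spectral theorem. On the index set
  of entries let \<open>G\<close> be the matrix of \<open>P_T\<close>, a symmetric idempotent with rows \<open>G i\<close>, so that the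
  operator to be bounded is \<open>X = (\<Sum>i. (\<delta> i - p) * G i \<otimes> G i)\<close>. Conditioning on all but one
  coordinate gives
  \<open>E tr X^(2 h+2) = (\<Sum>i. p (1 - p) E \<langle>G i, (A^(2 h+1) - B^(2 h+1)) (G i)\<rangle>)\<close>, where \<open>A\<close> and \<open>B\<close> are \<open>X\<close> with \<open>\<delta> i\<close>
  set to 1 and 0. Since \<open>A - B = G i \<otimes> G i\<close>, the difference telescopes into products
  \<open>\<langle>G i, A^j (G i)\<rangle> * \<langle>G i, B^(2 h-j) (G i)\<rangle>\<close>, which log-convexity bounds by the two extreme ones. Because the
  \<open>G i \<otimes> G i\<close> sum to \<open>P_T\<close>, the result is the self-bounding recursion
  \<open>E tr X^(2 h+2) \<le> K (E tr X^(2 h+1) + 2 p E tr X^(2 h))\<close> with \<open>K = (2 h + 1) L\<close>,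
  where \<open>L\<close> is the coherence bound on \<open>G i i\<close>. Absorbing the odd moment by AM-GM and iterating \<open>k \<approx> \<beta> ln n\<close> times, Markov's inequality for \<open>tr X^(2 k)\<close> finishes the proof.\<close>

section \<open>Inner products of functions on an index set\<close>

definition ip :: "'i set \<Rightarrow> ('i \<Rightarrow> real) \<Rightarrow> ('i \<Rightarrow> real) \<Rightarrow> real" where
  "ip I f g = (\<Sum>i\<in>I. f i * g i)"

lemma ip_commute: "ip I f g = ip I g f"
  by (simp add: ip_def mult.commute)

lemma ip_self_nonneg: "0 \<le> ip I f f"
  by (simp add: ip_def sum_nonneg)

lemma ip_cong: "(\<And>i. i \<in> I \<Longrightarrow> f i = f' i) \<Longrightarrow> (\<And>i. i \<in> I \<Longrightarrow> g i = g' i) \<Longrightarrow> ip I f g = ip I f' g'"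
  by (simp add: ip_def)

lemma ip_Cauchy_Schwarz: "(ip I f g)\<^sup>2 \<le> ip I f f * ip I g g"
  using Cauchy_Schwarz_ineq_sum[of f g I] by (simp add: ip_def power2_eq_square)

lemma ip_add_right: "ip I f (\<lambda>j. g j + h j) = ip I f g + ip I f h"
  by (simp add: ip_def distrib_left sum.distrib)

lemma ip_scale_right: "ip I f (\<lambda>j. c * g j) = c * ip I f g"
  by (simp add: ip_def sum_distrib_left mult_ac)

lemma ip_sum_right: "ip I f (\<lambda>j. \<Sum>i\<in>A. h i j) = (\<Sum>i\<in>A. ip I f (h i))"
  unfolding ip_def sum_distrib_left by (rule sum.swap)

lemma ip_Young: "2 * c * ip I f g \<le> ip I f f + c\<^sup>2 * ip I g g"
proof -
  have "0 \<le> (\<Sum>i\<in>I. (f i - c * g i)\<^sup>2)"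
    by (rule sum_nonneg) simp
  also have "\<dots> = ip I f f + c\<^sup>2 * ip I g g - 2 * c * ip I f g"
    by (simp add: ip_def power2_eq_square algebra_simps sum.distrib sum_subtractf sum_distrib_left)
  finally show ?thesis by simp
qed

section \<open>Convex and log-convex sequences\<close>

lemma geometric_le_arithmetic:
  fixes x :: real
  assumes "x\<^sup>2 \<le> a * b" "0 \<le> a" "0 \<le> b"
  shows "2 * x \<le> a + b"
proof (rule power2_le_imp_le)
  have "(2 * x)\<^sup>2 \<le> 4 * (a * b)" using assms(1) by (simp add: power_mult_distrib)
  also have "\<dots> \<le> (a + b)\<^sup>2"
    using zero_le_power2[of "a - b"] by (simp add: power2_eq_square algebra_simps)
  finally show "(2 * x)\<^sup>2 \<le> (a + b)\<^sup>2" .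
qed (use assms in simp)

text \<open>A leftmost maximiser in the interior would strictly exceed its left neighbour and be at
  least its right one, against midpoint convexity.\<close>

lemma midpoint_convex_le_max:
  fixes \<phi> :: "nat \<Rightarrow> real"
  assumes "\<And>i. 0 < i \<Longrightarrow> i < h \<Longrightarrow> 2 * \<phi> i \<le> \<phi> (i - 1) + \<phi> (i + 1)" and "i \<le> h"
  shows "\<phi> i \<le> max (\<phi> 0) (\<phi> h)"
proof -
  define M where "M = Max (\<phi> ` {..h})"
  define l where "l = (LEAST l. l \<le> h \<and> \<phi> l = M)"
  have "M \<in> \<phi> ` {..h}" unfolding M_def by (rule Max_in) auto
  then have ex: "\<exists>l. l \<le> h \<and> \<phi> l = M" by auto
  have le: "\<phi> j \<le> M" if "j \<le> h" for j
    unfolding M_def using that by (intro Max_ge) auto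
  have l: "l \<le> h" "\<phi> l = M"
    using LeastI_ex[OF ex] by (auto simp: l_def)
  have "l = 0 \<or> l = h"
  proof (rule ccontr)
    assume *: "\<not> (l = 0 \<or> l = h)"
    then have "\<phi> (l - 1) \<noteq> M"
      using not_less_Least[of "l - 1" "\<lambda>l. l \<le> h \<and> \<phi> l = M"] l(1) by (auto simp: l_def)
    then have "\<phi> (l - 1) < M" using le[of "l - 1"] l(1) by linarith
    moreover have "\<phi> (l + 1) \<le> M" using le[of "l + 1"] * l(1) by simp
    moreover have "2 * \<phi> l \<le> \<phi> (l - 1) + \<phi> (l + 1)" using * l(1) by (intro assms(1)) auto
    ultimately show False using l(2) by linarith
  qed
  then show ?thesis using l le[OF assms(2)] by auto
qed

text \<open>The ratios \<open>b (Suc k) / b k\<close> are nondecreasing; the cross-multiplied form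
  stays meaningful when terms vanish.\<close>

lemma log_convex_shift:
  fixes b :: "nat \<Rightarrow> real"
  assumes lc: "\<And>j. (b (Suc j))\<^sup>2 \<le> b j * b (Suc (Suc j))" and nn: "\<And>j. 0 \<le> b j"
  shows "b 1 * b k \<le> b 0 * b (Suc k)"
proof (induction k)
  case (Suc k)
  show ?case
  proof (cases "b k = 0")
    case True
    then have "b (Suc k) = 0" using lc[of k] by simp
    then show ?thesis using nn by simp
  next
    case False
    then have pos: "0 < b k" using nn[of k] by simp
    have "b 1 * b k * b (Suc k) \<le> b 0 * b (Suc k) * b (Suc k)"
      using Suc nn by (intro mult_right_mono) auto
    also have "\<dots> = b 0 * (b (Suc k))\<^sup>2" by (simp add: power2_eq_square)
    also have "\<dots> \<le> b 0 * (b k * b (Suc (Suc k)))"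
      using lc nn by (intro mult_left_mono) auto
    finally have "b k * (b 1 * b (Suc k)) \<le> b k * (b 0 * b (Suc (Suc k)))"
      by (simp add: mult_ac)
    then show ?thesis using pos by simp
  qed
qed (simp add: mult.commute)

text \<open>With \<open>b j\<close> the squared norm of the \<open>j\<close>-th iterate of an
  operator on a vector, this compares one application with \<open>k\<close> of them.\<close>

lemma log_convex_power_le:
  fixes b :: "nat \<Rightarrow> real"
  assumes lc: "\<And>j. (b (Suc j))\<^sup>2 \<le> b j * b (Suc (Suc j))" and nn: "\<And>j. 0 \<le> b j"
    and "b 0 \<le> 1" and "0 < k"
  shows "b 1 ^ k \<le> b k"
  using \<open>0 < k\<close>
proof (induction k rule: nat_induct_non_zero)
  case (Suc k)
  have "b 1 ^ Suc k \<le> b 1 * b k" using Suc nn by (simp add: mult_left_mono)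
  also have "\<dots> \<le> b 0 * b (Suc k)" using lc nn by (rule log_convex_shift)
  also have "\<dots> \<le> 1 * b (Suc k)" using nn assms(3) by (intro mult_right_mono) auto
  finally show ?case by simp
qed simp

section \<open>Expectations over independent Bernoulli variables\<close>

lemma finite_set_Pi_bernoulli:
  "finite I \<Longrightarrow> finite (set_pmf (Pi_pmf I False (\<lambda>_. bernoulli_pmf p)))"
  by (rule finite_subset[OF set_Pi_pmf_subset']) auto

text \<open>By independence, coordinate \<open>i\<close> is averaged separately, so that it can be
  flipped while the others stay fixed.\<close>

lemma expectation_Pi_bernoulli_split:
  fixes F :: "('i \<Rightarrow> bool) \<Rightarrow> real"
  assumes "finite I" "i \<in> I" "0 \<le> p" "p \<le> 1"
  shows "measure_pmf.expectation (Pi_pmf I False (\<lambda>_. bernoulli_pmf p)) F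
    = measure_pmf.expectation (Pi_pmf (I - {i}) False (\<lambda>_. bernoulli_pmf p))
        (\<lambda>g. p * F (g(i := True)) + (1 - p) * F (g(i := False)))"
proof -
  let ?P = "Pi_pmf (I - {i}) False (\<lambda>_. bernoulli_pmf p)"
  have fin: "finite (set_pmf ?P)" using assms by (simp add: finite_set_Pi_bernoulli)
  have "Pi_pmf I False (\<lambda>_. bernoulli_pmf p)
      = bernoulli_pmf p \<bind> (\<lambda>y. map_pmf (\<lambda>f. f(i := y)) ?P)"
    using Pi_pmf_insert'[of "I - {i}" i False "\<lambda>_. bernoulli_pmf p"] assms
    by (simp add: insert_absorb map_pmf_def)
  then have "measure_pmf.expectation (Pi_pmf I False (\<lambda>_. bernoulli_pmf p)) F
      = (\<Sum>y\<in>UNIV. pmf (bernoulli_pmf p) y *\<^sub>R measure_pmf.expectation (map_pmf (\<lambda>f. f(i := y)) ?P) F)"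
    using fin by (simp add: pmf_expectation_bind[where A = UNIV])
  also have "\<dots> = p * measure_pmf.expectation ?P (\<lambda>g. F (g(i := True)))
      + (1 - p) * measure_pmf.expectation ?P (\<lambda>g. F (g(i := False)))"
    using assms by (simp add: UNIV_bool)
  finally show ?thesis
    using fin by (simp add: integrable_measure_pmf_finite)
qed

text \<open>The discrete counterpart of Gaussian integration by parts.\<close>

lemma expectation_centered_bernoulli_le:
  fixes f h :: "('i \<Rightarrow> bool) \<Rightarrow> real"
  assumes "finite I" "i \<in> I" "0 \<le> p" "p \<le> 1" and nn: "\<And>\<delta>. 0 \<le> h \<delta>"
    and diff: "\<And>g. f (g(i := True)) - f (g(i := False)) \<le> h (g(i := True)) + h (g(i := False))"
  shows "measure_pmf.expectation (Pi_pmf I False (\<lambda>_. bernoulli_pmf p)) (\<lambda>\<delta>. (of_bool (\<delta> i) - p) * f \<delta>)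
    \<le> measure_pmf.expectation (Pi_pmf I False (\<lambda>_. bernoulli_pmf p)) (\<lambda>\<delta>. (of_bool (\<delta> i) + p) * h \<delta>)"
  unfolding expectation_Pi_bernoulli_split[OF assms(1-4)]
proof (rule integral_mono)
  fix g :: "'i \<Rightarrow> bool"
  let ?a = "g(i := True)" and ?b = "g(i := False)"
  have "p * (1 - p) * (f ?a - f ?b) \<le> p * (1 - p) * (h ?a + h ?b)"
    using assms by (intro mult_left_mono diff) auto
  \<comment> \<open>Enlarges the weight at True from \<open>p * (1 - p)\<close> to
    \<open>p * (1 + p)\<close>; both weights are then those of
    \<open>of_bool (\<delta> i) + p\<close> under the Bernoulli law.\<close>
  also have "\<dots> \<le> p * (1 + p) * h ?a + p * (1 - p) * h ?b"
    using mult_nonneg_nonneg[OF _ nn[of ?a], of "p * p"] assms(3) by (simp add: algebra_simps)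
  finally show "p * ((of_bool (?a i) - p) * f ?a) + (1 - p) * ((of_bool (?b i) - p) * f ?b)
    \<le> p * ((of_bool (?a i) + p) * h ?a) + (1 - p) * ((of_bool (?b i) + p) * h ?b)"
    by (simp add: algebra_simps)
qed (simp_all add: integrable_measure_pmf_finite finite_set_Pi_bernoulli assms)

text \<open>For an idempotent kernel \<open>G\<close> the rows \<open>G i\<close> are the images of the standard basis under a
  projection, so that summing \<open>\<langle>G i, A (G i)\<rangle>\<close> over \<open>i\<close> is the trace of \<open>A\<close> on its range.\<close>

locale projection_kernel =
  fixes I :: "'i set" and G :: "'i \<Rightarrow> 'i \<Rightarrow> real"
  assumes fin: "finite I"
    and sym: "i \<in> I \<Longrightarrow> j \<in> I \<Longrightarrow> G i j = G j i"
    and idem: "i \<in> I \<Longrightarrow> j \<in> I \<Longrightarrow> ip I (G i) (G j) = G i j"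
begin

section \<open>Powers and traces of weighted sums of rank-one operators\<close>

text \<open>On \<open>I\<close> this is the matrix product \<open>G D G\<close> with
  \<open>D\<close> the diagonal matrix of \<open>d\<close>, by symmetry of \<open>G\<close>.\<close>

definition frame_op :: "('i \<Rightarrow> real) \<Rightarrow> ('i \<Rightarrow> real) \<Rightarrow> 'i \<Rightarrow> real" where
  "frame_op d z = (\<lambda>j. \<Sum>i\<in>I. d i * ip I (G i) z * G i j)"

text \<open>The trace of \<open>G X^q G\<close> for \<open>X = frame_op d\<close>; exponent 0 thus
  gives the trace of \<open>G\<close>, not of the identity.\<close>

definition trace_pow :: "('i \<Rightarrow> real) \<Rightarrow> nat \<Rightarrow> real" where
  "trace_pow d q = (\<Sum>i\<in>I. ip I (G i) ((frame_op d ^^ q) (G i)))"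

lemma ip_frame_op: "ip I y (frame_op d z) = (\<Sum>i\<in>I. d i * ip I (G i) z * ip I (G i) y)"
  unfolding frame_op_def ip_sum_right ip_scale_right by (simp add: ip_commute)

lemma frame_op_selfadjoint: "ip I (frame_op d y) z = ip I y (frame_op d z)"
  by (subst ip_commute) (simp add: ip_frame_op mult_ac)

lemma frame_op_pow_selfadjoint:
  "ip I ((frame_op d ^^ q) y) z = ip I y ((frame_op d ^^ q) z)"
proof (induction q arbitrary: z)
  case (Suc q)
  have "ip I ((frame_op d ^^ Suc q) y) z = ip I ((frame_op d ^^ q) y) (frame_op d z)"
    by (simp add: frame_op_selfadjoint)
  also have "\<dots> = ip I y ((frame_op d ^^ q) (frame_op d z))" by (rule Suc)
  finally show ?case by (simp only: funpow_Suc_right o_apply)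
qed simp

lemma ip_frame_op_pow:
  "ip I ((frame_op d ^^ j) y) ((frame_op d ^^ l) z) = ip I y ((frame_op d ^^ (j + l)) z)"
  by (simp add: frame_op_pow_selfadjoint funpow_add)

lemma frame_op_add: "frame_op d (\<lambda>j. y j + c * z j) = (\<lambda>j. frame_op d y j + c * frame_op d z j)"
  by (simp add: frame_op_def ip_add_right ip_scale_right algebra_simps sum.distrib sum_distrib_left)

lemma frame_op_pow_add:
  "(frame_op d ^^ q) (\<lambda>j. y j + c * z j) = (\<lambda>j. (frame_op d ^^ q) y j + c * (frame_op d ^^ q) z j)"
  by (induction q) (simp_all add: frame_op_add)

text \<open>The rank-one operators of the rows sum to \<open>G G = G\<close>, which fixes each row
  \<open>G l\<close>.\<close>

lemma kernel_sum: assumes "l \<in> I" shows "(\<Sum>i\<in>I. ip I (G l) (G i) * ip I w (G i)) = ip I w (G l)"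
proof -
  have "(\<Sum>i\<in>I. ip I (G l) (G i) * ip I w (G i)) = ip I w (\<lambda>j. \<Sum>i\<in>I. G l i * G i j)"
    using assms by (simp add: ip_sum_right ip_scale_right idem)
  also have "\<dots> = ip I w (G l)"
  proof (rule ip_cong)
    fix j assume j: "j \<in> I"
    have "(\<Sum>i\<in>I. G l i * G i j) = ip I (G l) (G j)"
      using j by (simp add: ip_def sym)
    then show "(\<Sum>i\<in>I. G l i * G i j) = G l j" using j assms by (simp add: idem)
  qed simp
  finally show ?thesis .
qed

text \<open>One factor is expanded into rank-one terms and the outer sum collapses by
  \<open>kernel_sum\<close>, as in cyclicity of the trace. This exposes the weight
  \<open>d i\<close> as a factor for the integration by parts.\<close>

lemma trace_pow_Suc:
  "trace_pow d (Suc q) = (\<Sum>i\<in>I. d i * ip I (G i) ((frame_op d ^^ q) (G i)))"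
proof -
  have "trace_pow d (Suc q)
      = (\<Sum>i\<in>I. \<Sum>l\<in>I. d l * (ip I (G l) (G i) * ip I ((frame_op d ^^ q) (G l)) (G i)))"
    by (simp add: trace_pow_def ip_frame_op frame_op_pow_selfadjoint mult_ac)
  also have "\<dots> = (\<Sum>l\<in>I. d l * (\<Sum>i\<in>I. ip I (G l) (G i) * ip I ((frame_op d ^^ q) (G l)) (G i)))"
    by (subst sum.swap) (simp add: sum_distrib_left)
  also have "\<dots> = (\<Sum>l\<in>I. d l * ip I ((frame_op d ^^ q) (G l)) (G l))"
    by (intro sum.cong refl) (simp add: kernel_sum)
  finally show ?thesis by (simp add: frame_op_pow_selfadjoint)
qed

lemma trace_pow_even:
  "trace_pow d (2 * k) = (\<Sum>i\<in>I. ip I ((frame_op d ^^ k) (G i)) ((frame_op d ^^ k) (G i)))"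
  by (simp add: trace_pow_def ip_frame_op_pow mult_2)

lemma trace_pow_even_nonneg: "0 \<le> trace_pow d (2 * k)"
  by (simp add: trace_pow_even sum_nonneg ip_self_nonneg)

text \<open>Odd moments have no definite sign; Young's inequality between consecutive iterates
  bounds them by the neighbouring even ones.\<close>

lemma trace_pow_Young:
  "2 * c * trace_pow d (Suc (2 * k)) \<le> trace_pow d (2 * Suc k) + c\<^sup>2 * trace_pow d (2 * k)"
proof -
  have "2 * c * trace_pow d (Suc (2 * k))
     = (\<Sum>i\<in>I. 2 * c * ip I ((frame_op d ^^ Suc k) (G i)) ((frame_op d ^^ k) (G i)))"
    unfolding ip_frame_op_pow trace_pow_def sum_distrib_left by (simp only: mult_2 add_Suc)
  also have "\<dots> \<le> (\<Sum>i\<in>I. ip I ((frame_op d ^^ Suc k) (G i)) ((frame_op d ^^ Suc k) (G i))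
      + c\<^sup>2 * ip I ((frame_op d ^^ k) (G i)) ((frame_op d ^^ k) (G i)))"
    by (intro sum_mono ip_Young)
  also have "\<dots> = trace_pow d (2 * Suc k) + c\<^sup>2 * trace_pow d (2 * k)"
    unfolding trace_pow_even by (simp add: sum.distrib sum_distrib_left)
  finally show ?thesis .
qed

text \<open>\<open>G i i\<close> is the squared norm of row \<open>i\<close>, hence at least the
  square of its own diagonal entry.\<close>

lemma kernel_diag_bounds: assumes "i \<in> I" shows "0 \<le> G i i" "G i i \<le> 1"
proof -
  have eq: "ip I (G i) (G i) = G i i" using assms by (simp add: idem)
  show "0 \<le> G i i" using ip_self_nonneg[of I "G i"] eq by simp
  have "(G i i)\<^sup>2 \<le> (\<Sum>j\<in>I. (G i j)\<^sup>2)"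
    using assms fin by (intro member_le_sum) auto
  also have "\<dots> = G i i" using eq by (simp add: ip_def power2_eq_square)
  finally have "(G i i)\<^sup>2 \<le> G i i" .
  then show "G i i \<le> 1"
    using power_strict_increasing[of 1 2 "G i i"] by (cases "G i i \<le> 1") auto
qed

lemma trace_pow_0_le: "trace_pow d 0 \<le> real (card I)"
proof -
  have "trace_pow d 0 \<le> (\<Sum>i\<in>I. 1)"
    unfolding trace_pow_def by (intro sum_mono) (simp add: idem kernel_diag_bounds)
  then show ?thesis by simp
qed

text \<open>After at least one application the vector lies in the range of the projection, where
  evaluation at \<open>j\<close> is pairing with \<open>G j\<close>.\<close>

lemma frame_op_pow_eq_ip:
  assumes "j \<in> I"
  shows "(frame_op d ^^ Suc k) z j = ip I ((frame_op d ^^ Suc k) (G j)) z"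
proof -
  have "frame_op d y j = ip I (G j) (frame_op d y)" for y
    using assms by (simp add: ip_frame_op) (simp add: frame_op_def idem)
  then have "(frame_op d ^^ Suc k) z j = ip I (G j) ((frame_op d ^^ Suc k) z)" by simp
  then show ?thesis by (simp only: frame_op_pow_selfadjoint)
qed

text \<open>Log-convexity passes from one application to \<open>k\<close>; the entries of the
  \<open>k\<close>-th iterate are pairings with \<open>z\<close>, and Cauchy-Schwarz in each entry
  yields the trace.\<close>

lemma frame_op_norm_le_trace:
  assumes "ip I z z \<le> 1" "0 < k"
  shows "(ip I (frame_op d z) (frame_op d z)) ^ k \<le> trace_pow d (2 * k)"
proof -
  define b where "b j = ip I ((frame_op d ^^ j) z) ((frame_op d ^^ j) z)" for j
  have "b 1 ^ k \<le> b k"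
  proof (rule log_convex_power_le)
    fix j
    have "b (Suc j) = ip I ((frame_op d ^^ j) z) ((frame_op d ^^ Suc (Suc j)) z)"
      unfolding b_def ip_frame_op_pow by simp
    then show "(b (Suc j))\<^sup>2 \<le> b j * b (Suc (Suc j))"
      unfolding b_def by (simp only: ip_Cauchy_Schwarz)
  qed (use assms in \<open>auto simp: b_def ip_self_nonneg\<close>)
  also have "b k \<le> trace_pow d (2 * k)"
  proof -
    obtain k' where k': "k = Suc k'" using assms(2) gr0_implies_Suc by auto
    have "b k = (\<Sum>j\<in>I. ((frame_op d ^^ k) z j)\<^sup>2)"
      by (simp add: b_def ip_def power2_eq_square)
    also have "\<dots> = (\<Sum>j\<in>I. (ip I ((frame_op d ^^ k) (G j)) z)\<^sup>2)"
      unfolding k' by (intro sum.cong refl) (simp only: frame_op_pow_eq_ip)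
    also have "\<dots> \<le> (\<Sum>j\<in>I. ip I ((frame_op d ^^ k) (G j)) ((frame_op d ^^ k) (G j)) * 1)"
      using assms(1)
      by (intro sum_mono order_trans[OF ip_Cauchy_Schwarz] mult_left_mono ip_self_nonneg)
    finally show ?thesis by (simp add: trace_pow_even)
  qed
  finally show ?thesis by (simp add: b_def)
qed

section \<open>Effect of a rank-one change on powers\<close>

text \<open>Telescoping \<open>A^q - B^q\<close> into the terms
  \<open>A^j (A - B) B^(q-1-j)\<close>: as \<open>A - B\<close> is the rank-one operator of
  \<open>x\<close>, each term splits into a product of two scalars.\<close>

lemma frame_op_pow_diff:
  assumes "\<And>z. frame_op d1 z = (\<lambda>j. frame_op d0 z j + ip I x z * x j)"
  shows "ip I y ((frame_op d1 ^^ q) z) - ip I y ((frame_op d0 ^^ q) z)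
    = (\<Sum>j<q. ip I y ((frame_op d1 ^^ j) x) * ip I x ((frame_op d0 ^^ (q - 1 - j)) z))"
proof (induction q arbitrary: z)
  case (Suc q)
  have "ip I y ((frame_op d1 ^^ Suc q) z)
      = ip I y ((frame_op d1 ^^ q) (frame_op d0 z)) + ip I x z * ip I y ((frame_op d1 ^^ q) x)"
    by (simp only: funpow_Suc_right o_apply assms frame_op_pow_add ip_add_right ip_scale_right)
  then have "ip I y ((frame_op d1 ^^ Suc q) z) - ip I y ((frame_op d0 ^^ Suc q) z)
      = (\<Sum>j<q. ip I y ((frame_op d1 ^^ j) x) * ip I x ((frame_op d0 ^^ (q - 1 - j)) (frame_op d0 z)))
        + ip I x z * ip I y ((frame_op d1 ^^ q) x)"
    by (simp only: Suc[symmetric] funpow_Suc_right o_apply)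
  also have "(\<Sum>j<q. ip I y ((frame_op d1 ^^ j) x) * ip I x ((frame_op d0 ^^ (q - 1 - j)) (frame_op d0 z)))
     = (\<Sum>j<q. ip I y ((frame_op d1 ^^ j) x) * ip I x ((frame_op d0 ^^ (Suc q - 1 - j)) z))"
  proof (intro sum.cong refl)
    fix j assume "j \<in> {..<q}"
    then have "Suc q - 1 - j = Suc (q - 1 - j)" by auto
    then show "ip I y ((frame_op d1 ^^ j) x) * ip I x ((frame_op d0 ^^ (q - 1 - j)) (frame_op d0 z))
       = ip I y ((frame_op d1 ^^ j) x) * ip I x ((frame_op d0 ^^ (Suc q - 1 - j)) z)"
      by (simp only: funpow_Suc_right o_apply)
  qed
  finally show ?case by simp
qed simp

text \<open>In the proof \<open>\<phi>\<close> collects the products with both exponents even; by Cauchy-Schwarz it is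
  midpoint convex, and the products with odd exponents lie below the mean of their neighbours.\<close>

lemma mixed_moment_le:
  assumes "j \<le> 2 * h"
  shows "ip I x ((frame_op d1 ^^ j) x) * ip I x ((frame_op d0 ^^ (2 * h - j)) x)
    \<le> ip I x x * (ip I ((frame_op d1 ^^ h) x) ((frame_op d1 ^^ h) x)
        + ip I ((frame_op d0 ^^ h) x) ((frame_op d0 ^^ h) x))"
proof -
  define a where "a d q = ip I x ((frame_op d ^^ q) x)" for d q
  have even_nn: "0 \<le> a d (2 * i)" for d i
    using ip_self_nonneg[of I "(frame_op d ^^ i) x"] by (simp add: a_def ip_frame_op_pow mult_2)
  have cs: "(a d (i + l))\<^sup>2 \<le> a d (2 * i) * a d (2 * l)" for d i l
    using ip_Cauchy_Schwarz[of I "(frame_op d ^^ i) x" "(frame_op d ^^ l) x"]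
    by (simp add: a_def ip_frame_op_pow mult_2)
  define \<phi> where "\<phi> i = a d1 (2 * i) * a d0 (2 * (h - i))" for i
  have \<phi>nn: "0 \<le> \<phi> i" for i by (simp add: \<phi>_def even_nn)
  \<comment> \<open>Cauchy-Schwarz in each factor, then AM-GM. The pair \<open>i - 1\<close>,
    \<open>i + 1\<close> gives midpoint convexity; the pair \<open>i\<close>, \<open>i + 1\<close>
    reaches the odd exponents.\<close>
  have mid: "2 * (a d1 (i + l) * a d0 ((h - i) + (h - l))) \<le> \<phi> i + \<phi> l" for i l
  proof (rule geometric_le_arithmetic)
    have "(a d1 (i + l))\<^sup>2 * (a d0 ((h - i) + (h - l)))\<^sup>2
       \<le> (a d1 (2 * i) * a d1 (2 * l)) * (a d0 (2 * (h - i)) * a d0 (2 * (h - l)))"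
      by (intro mult_mono cs mult_nonneg_nonneg even_nn) simp
    then show "(a d1 (i + l) * a d0 ((h - i) + (h - l)))\<^sup>2 \<le> \<phi> i * \<phi> l"
      by (simp add: \<phi>_def power_mult_distrib mult_ac)
  qed (simp_all add: \<phi>nn)
  have even_le: "\<phi> i \<le> \<phi> 0 + \<phi> h" if "i \<le> h" for i
  proof -
    have "\<phi> i \<le> max (\<phi> 0) (\<phi> h)"
    proof (rule midpoint_convex_le_max[OF _ that])
      fix i assume "0 < i" "i < h"
      then have "(i - 1) + (i + 1) = 2 * i" "(h - (i - 1)) + (h - (i + 1)) = 2 * (h - i)" by auto
      then show "2 * \<phi> i \<le> \<phi> (i - 1) + \<phi> (i + 1)"
        using mid[of "i - 1" "i + 1"] unfolding \<phi>_def by metis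
    qed
    then show ?thesis using \<phi>nn[of 0] \<phi>nn[of h] by linarith
  qed
  have "a d1 j * a d0 (2 * h - j) \<le> \<phi> 0 + \<phi> h"
  proof (cases "even j")
    case True
    then obtain i where i: "j = 2 * i" by blast
    then have "2 * h - j = 2 * (h - i)" by auto
    then show ?thesis using even_le[of i] i assms by (simp add: \<phi>_def)
  next
    case False
    then obtain i where i: "j = 2 * i + 1" by (elim oddE)
    then have e: "i + (i + 1) = j" "(h - i) + (h - (i + 1)) = 2 * h - j" "i + 1 \<le> h"
      using assms by auto
    show ?thesis using mid[of i "i + 1"] even_le[of i] even_le[of "i + 1"] unfolding e(1,2)
      using e(3) by simp
  qed
  moreover have "\<phi> 0 + \<phi> h = ip I x x * (ip I ((frame_op d1 ^^ h) x) ((frame_op d1 ^^ h) x)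
        + ip I ((frame_op d0 ^^ h) x) ((frame_op d0 ^^ h) x))"
    unfolding ip_frame_op_pow by (simp add: \<phi>_def a_def mult_2 distrib_left)
  ultimately show ?thesis by (simp add: a_def)
qed

text \<open>The exponents \<open>j\<close> and \<open>2 * h - j\<close> of each telescoped term add
  up to \<open>2 * h\<close>, so all \<open>Suc (2 * h)\<close> terms share the bound of
  \<open>mixed_moment_le\<close>.\<close>

lemma frame_op_pow_diff_le:
  assumes "\<And>z. frame_op d1 z = (\<lambda>j. frame_op d0 z j + ip I x z * x j)"
  shows "ip I x ((frame_op d1 ^^ Suc (2 * h)) x) - ip I x ((frame_op d0 ^^ Suc (2 * h)) x)
    \<le> real (Suc (2 * h)) * ip I x x * (ip I ((frame_op d1 ^^ h) x) ((frame_op d1 ^^ h) x)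
        + ip I ((frame_op d0 ^^ h) x) ((frame_op d0 ^^ h) x))"
proof -
  have "ip I x ((frame_op d1 ^^ Suc (2 * h)) x) - ip I x ((frame_op d0 ^^ Suc (2 * h)) x)
     = (\<Sum>j<Suc (2 * h). ip I x ((frame_op d1 ^^ j) x) * ip I x ((frame_op d0 ^^ (2 * h - j)) x))"
    by (subst frame_op_pow_diff[OF assms]) (simp only: diff_Suc_1)
  also have "\<dots> \<le> (\<Sum>j<Suc (2 * h). ip I x x * (ip I ((frame_op d1 ^^ h) x) ((frame_op d1 ^^ h) x)
        + ip I ((frame_op d0 ^^ h) x) ((frame_op d0 ^^ h) x)))"
    by (intro sum_mono mixed_moment_le) auto
  finally show ?thesis by (simp add: algebra_simps)
qed

lemma frame_op_flip:
  assumes "i \<in> I" "d1 i = d0 i + 1" "\<And>l. l \<noteq> i \<Longrightarrow> d1 l = d0 l"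
  shows "frame_op d1 z = (\<lambda>j. frame_op d0 z j + ip I (G i) z * G i j)"
proof
  fix j
  have "frame_op d1 z j = (\<Sum>l\<in>I. d0 l * ip I (G l) z * G l j + (if l = i then ip I (G l) z * G l j else 0))"
    unfolding frame_op_def using assms by (intro sum.cong refl) (auto simp: algebra_simps)
  then show "frame_op d1 z j = frame_op d0 z j + ip I (G i) z * G i j"
    using assms(1) fin by (simp add: sum.distrib frame_op_def)
qed

section \<open>Moment recursion and tail bound under Bernoulli sampling\<close>

context
  fixes p L :: real
  assumes p: "0 \<le> p" "p \<le> 1" and L: "\<And>i. i \<in> I \<Longrightarrow> G i i \<le> L" "0 \<le> L"
begin

abbreviation (input) centered :: "('i \<Rightarrow> bool) \<Rightarrow> 'i \<Rightarrow> real" where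
  "centered \<delta> \<equiv> (\<lambda>i. of_bool (\<delta> i) - p)"

abbreviation (input) bernoulli_family :: "('i \<Rightarrow> bool) pmf" where
  "bernoulli_family \<equiv> Pi_pmf I False (\<lambda>_. bernoulli_pmf p)"

lemma integrable_bernoulli_family [simp]:
  fixes F :: "('i \<Rightarrow> bool) \<Rightarrow> real"
  shows "integrable bernoulli_family F"
  by (simp add: integrable_measure_pmf_finite finite_set_Pi_bernoulli fin)

lemma expectation_trace_pow_le:
  "measure_pmf.expectation bernoulli_family (\<lambda>\<delta>. trace_pow (centered \<delta>) (2 * Suc h))
    \<le> real (Suc (2 * h)) * L *
       (measure_pmf.expectation bernoulli_family (\<lambda>\<delta>. trace_pow (centered \<delta>) (Suc (2 * h)))
        + 2 * p * measure_pmf.expectation bernoulli_family (\<lambda>\<delta>. trace_pow (centered \<delta>) (2 * h)))"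
proof -
  define K where "K = real (Suc (2 * h)) * L"
  define f where "f i \<delta> = ip I (G i) ((frame_op (centered \<delta>) ^^ Suc (2 * h)) (G i))" for i \<delta>
  define g where "g i \<delta> = ip I ((frame_op (centered \<delta>) ^^ h) (G i)) ((frame_op (centered \<delta>) ^^ h) (G i))"
    for i \<delta>
  have K0: "0 \<le> K" using L by (simp add: K_def)
  have "measure_pmf.expectation bernoulli_family (\<lambda>\<delta>. trace_pow (centered \<delta>) (2 * Suc h))
      = measure_pmf.expectation bernoulli_family (\<lambda>\<delta>. \<Sum>i\<in>I. centered \<delta> i * f i \<delta>)"
    by (simp only: mult_Suc_right add_2_eq_Suc trace_pow_Suc f_def)
  also have "\<dots> = (\<Sum>i\<in>I. measure_pmf.expectation bernoulli_family (\<lambda>\<delta>. centered \<delta> i * f i \<delta>))"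
    by (rule Bochner_Integration.integral_sum) simp
  also have "\<dots> \<le> (\<Sum>i\<in>I. measure_pmf.expectation bernoulli_family (\<lambda>\<delta>. (of_bool (\<delta> i) + p) * (K * g i \<delta>)))"
  proof (intro sum_mono expectation_centered_bernoulli_le[OF fin _ p])
    fix i \<delta> assume i: "i \<in> I"
    show "0 \<le> K * g i \<delta>" using K0 by (simp add: g_def ip_self_nonneg)
    let ?a = "\<delta>(i := True)" and ?b = "\<delta>(i := False)"
    have "f i ?a - f i ?b \<le> real (Suc (2 * h)) * ip I (G i) (G i) * (g i ?a + g i ?b)"
      unfolding f_def g_def by (intro frame_op_pow_diff_le frame_op_flip i) auto
    also have "\<dots> \<le> K * (g i ?a + g i ?b)"
      unfolding K_def using i L(1)[OF i]
      by (intro mult_right_mono mult_left_mono) (auto simp: idem g_def ip_self_nonneg)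
    finally show "f i ?a - f i ?b \<le> K * g i ?a + K * g i ?b" by (simp add: algebra_simps)
  qed
  \<comment> \<open>Writing \<open>of_bool (\<delta> i) + p\<close> as the centered weight plus
    \<open>2 * p\<close> recovers the odd moment through \<open>trace_pow_Suc\<close> and leaves an
    even one.\<close>
  also have "\<dots> = measure_pmf.expectation bernoulli_family
      (\<lambda>\<delta>. K * ((\<Sum>i\<in>I. centered \<delta> i * g i \<delta>) + 2 * p * (\<Sum>i\<in>I. g i \<delta>)))"
    by (subst Bochner_Integration.integral_sum[symmetric])
       (simp_all add: sum_distrib_left sum.distrib[symmetric] algebra_simps)
  also have "\<dots> = measure_pmf.expectation bernoulli_family
      (\<lambda>\<delta>. K * (trace_pow (centered \<delta>) (Suc (2 * h)) + 2 * p * trace_pow (centered \<delta>) (2 * h)))"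
    by (simp only: trace_pow_Suc g_def ip_frame_op_pow mult_2) (simp only: trace_pow_def)
  finally show ?thesis by (simp add: K_def)
qed

text \<open>Young's inequality with \<open>c = K\<close> costs half of the left side; absorbing that
  half doubles \<open>2 * p * K\<close>. Passing to \<open>\<kappa>\<close> makes the factor uniform
  in \<open>h\<close>.\<close>

lemma expectation_trace_pow_step:
  assumes "real (Suc (2 * h)) * L \<le> \<kappa>"
  shows "measure_pmf.expectation bernoulli_family (\<lambda>\<delta>. trace_pow (centered \<delta>) (2 * Suc h))
    \<le> (\<kappa>\<^sup>2 + 4 * p * \<kappa>) * measure_pmf.expectation bernoulli_family (\<lambda>\<delta>. trace_pow (centered \<delta>) (2 * h))"
proof -
  define K where "K = real (Suc (2 * h)) * L"
  define E where "E q = measure_pmf.expectation bernoulli_family (\<lambda>\<delta>. trace_pow (centered \<delta>) q)" for q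
  have K: "0 \<le> K" "K \<le> \<kappa>" using assms L by (simp_all add: K_def)
  have "measure_pmf.expectation bernoulli_family (\<lambda>\<delta>. 2 * K * trace_pow (centered \<delta>) (Suc (2 * h)))
     \<le> measure_pmf.expectation bernoulli_family
         (\<lambda>\<delta>. trace_pow (centered \<delta>) (2 * Suc h) + K\<^sup>2 * trace_pow (centered \<delta>) (2 * h))"
    by (intro integral_mono trace_pow_Young) simp_all
  then have young: "2 * K * E (Suc (2 * h)) \<le> E (2 * Suc h) + K\<^sup>2 * E (2 * h)"
    by (simp add: E_def)
  have "E (2 * Suc h) \<le> K * (E (Suc (2 * h)) + 2 * p * E (2 * h))"
    unfolding E_def K_def by (rule expectation_trace_pow_le)
  then have "E (2 * Suc h) \<le> (K\<^sup>2 + 4 * p * K) * E (2 * h)"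
    using young by (simp add: algebra_simps)
  also have "\<dots> \<le> (\<kappa>\<^sup>2 + 4 * p * \<kappa>) * E (2 * h)"
    using K p unfolding E_def
    by (intro mult_right_mono add_mono power_mono mult_left_mono
        Bochner_Integration.integral_nonneg trace_pow_even_nonneg) auto
  finally show ?thesis by (simp add: E_def)
qed

lemma expectation_trace_pow_bound:
  assumes "2 * real k * L \<le> \<kappa>"
  shows "measure_pmf.expectation bernoulli_family (\<lambda>\<delta>. trace_pow (centered \<delta>) (2 * k))
    \<le> (\<kappa>\<^sup>2 + 4 * p * \<kappa>) ^ k * real (card I)"
proof -
  have \<kappa>: "0 \<le> \<kappa>" using assms L by (meson mult_nonneg_nonneg of_nat_0_le_iff order_trans zero_le_numeral)
  have "h \<le> k \<Longrightarrow> measure_pmf.expectation bernoulli_family (\<lambda>\<delta>. trace_pow (centered \<delta>) (2 * h))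
    \<le> (\<kappa>\<^sup>2 + 4 * p * \<kappa>) ^ h * real (card I)" for h
  proof (induction h)
    case 0
    have "measure_pmf.expectation bernoulli_family (\<lambda>\<delta>. trace_pow (centered \<delta>) 0)
       \<le> measure_pmf.expectation bernoulli_family (\<lambda>_. real (card I))"
      by (intro integral_mono trace_pow_0_le) simp_all
    then show ?case by simp
  next
    case (Suc h)
    \<comment> \<open>Since \<open>Suc h \<le> k\<close>, also \<open>2 * h + 1 \<le> 2 * k\<close>,
      so one \<open>\<kappa>\<close> serves all steps.\<close>
    have "real (Suc (2 * h)) * L \<le> 2 * real k * L"
      using Suc.prems L(2) by (intro mult_right_mono) auto
    then have "measure_pmf.expectation bernoulli_family (\<lambda>\<delta>. trace_pow (centered \<delta>) (2 * Suc h))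
      \<le> (\<kappa>\<^sup>2 + 4 * p * \<kappa>) * measure_pmf.expectation bernoulli_family (\<lambda>\<delta>. trace_pow (centered \<delta>) (2 * h))"
      using assms by (intro expectation_trace_pow_step) linarith
    also have "\<dots> \<le> (\<kappa>\<^sup>2 + 4 * p * \<kappa>) * ((\<kappa>\<^sup>2 + 4 * p * \<kappa>) ^ h * real (card I))"
      using Suc p \<kappa> by (intro mult_left_mono) auto
    finally show ?case by (simp add: mult.assoc)
  qed
  then show ?thesis by simp
qed

lemma prob_frame_op_norm_le:
  assumes "2 * real k * L \<le> \<kappa>" "0 < k" "0 < s"
  shows "1 - ((\<kappa>\<^sup>2 + 4 * p * \<kappa>) / s\<^sup>2) ^ k * real (card I)
    \<le> measure_pmf.prob bernoulli_family
       {\<delta>. \<forall>z. ip I z z \<le> 1 \<longrightarrow> ip I (frame_op (centered \<delta>) z) (frame_op (centered \<delta>) z) \<le> s\<^sup>2}"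
proof -
  let ?good = "{\<delta>. \<forall>z. ip I z z \<le> 1 \<longrightarrow> ip I (frame_op (centered \<delta>) z) (frame_op (centered \<delta>) z) \<le> s\<^sup>2}"
  define bad where "bad = {\<delta>. (s\<^sup>2) ^ k \<le> trace_pow (centered \<delta>) (2 * k)}"
  have "measure_pmf.prob bernoulli_family bad
     \<le> measure_pmf.expectation bernoulli_family (\<lambda>\<delta>. trace_pow (centered \<delta>) (2 * k)) / (s\<^sup>2) ^ k"
    using integral_Markov_inequality_measure[of bernoulli_family
        "\<lambda>\<delta>. trace_pow (centered \<delta>) (2 * k)" "{}" "(s\<^sup>2) ^ k"] assms(3)
    by (simp add: bad_def trace_pow_even_nonneg)
  also have "\<dots> \<le> ((\<kappa>\<^sup>2 + 4 * p * \<kappa>) ^ k * real (card I)) / (s\<^sup>2) ^ k"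
    by (intro divide_right_mono expectation_trace_pow_bound assms(1)) simp
  also have "\<dots> = ((\<kappa>\<^sup>2 + 4 * p * \<kappa>) / s\<^sup>2) ^ k * real (card I)"
    by (simp add: power_divide)
  finally have "1 - ((\<kappa>\<^sup>2 + 4 * p * \<kappa>) / s\<^sup>2) ^ k * real (card I) \<le> measure_pmf.prob bernoulli_family (- bad)"
    by (subst measure_pmf.prob_compl[of bad, simplified, folded Compl_eq_Diff_UNIV]) simp
  also have "\<dots> \<le> measure_pmf.prob bernoulli_family ?good"
  proof (rule measure_pmf.finite_measure_mono)
    show "- bad \<subseteq> ?good"
    proof safe
      fix \<delta> z assume "\<delta> \<notin> bad" and z: "ip I z z \<le> 1"
      then have "ip I (frame_op (centered \<delta>) z) (frame_op (centered \<delta>) z) ^ k \<le> (s\<^sup>2) ^ k"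
        using frame_op_norm_le_trace[OF z assms(2), of "centered \<delta>"] by (simp add: bad_def)
      then show "ip I (frame_op (centered \<delta>) z) (frame_op (centered \<delta>) z) \<le> s\<^sup>2"
        using assms(2) by (simp add: ip_self_nonneg)
    qed
  qed simp
  finally show ?thesis .
qed

end

end

section \<open>Coherence and the matrix of \<open>P_T\<close>\<close>

lemma proj_mat_commute: "proj_mat r u i j = proj_mat r u j i"
  by (simp add: proj_mat_def mult.commute)

lemma proj_mat_idem:
  assumes "orthonormal_family d r u"
  shows "(\<Sum>j<d. proj_mat r u a j * proj_mat r u b j) = proj_mat r u a b"
proof -
  have "(\<Sum>j<d. proj_mat r u a j * proj_mat r u b j)
      = (\<Sum>j<d. \<Sum>k<r. \<Sum>l<r. u k a * u l b * (u k j * u l j))"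
    by (simp add: proj_mat_def sum_product mult_ac)
  also have "\<dots> = (\<Sum>k<r. \<Sum>l<r. \<Sum>j<d. u k a * u l b * (u k j * u l j))"
    by (subst sum.swap, rule sum.cong[OF refl], rule sum.swap)
  also have "\<dots> = (\<Sum>k<r. \<Sum>l<r. u k a * u l b * (if k = l then 1 else 0))"
    using assms by (intro sum.cong refl) (simp add: orthonormal_family_def flip: sum_distrib_left)
  also have "\<dots> = proj_mat r u a b"
    by (simp add: proj_mat_def if_distrib[of "\<lambda>x. _ * x"] cong: if_cong)
  finally show ?thesis .
qed

lemma compl_proj_mat_idem:
  assumes "orthonormal_family d r u" "a < d" "b < d"
  shows "(\<Sum>j<d. (of_bool (a = j) - proj_mat r u a j) * (of_bool (b = j) - proj_mat r u b j))
    = of_bool (a = b) - proj_mat r u a b"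
proof -
  have "(\<Sum>j<d. (of_bool (a = j) - proj_mat r u a j) * (of_bool (b = j) - proj_mat r u b j))
    = (\<Sum>j<d. (if j = a then of_bool (a = b) else 0)) - (\<Sum>j<d. (if j = a then proj_mat r u b j else 0))
      - (\<Sum>j<d. (if j = b then proj_mat r u a j else 0)) + (\<Sum>j<d. proj_mat r u a j * proj_mat r u b j)"
    unfolding sum.distrib[symmetric] sum_subtractf[symmetric]
    by (intro sum.cong refl) (auto simp: algebra_simps)
  then show ?thesis
    using assms by (simp add: proj_mat_idem proj_mat_commute[of r u b a])
qed

text \<open>By idempotence the diagonal entry is the squared norm of a projected basis vector, which
  the coherence controls.\<close>

lemma proj_mat_diag_le:
  assumes "orthonormal_family d r u" "0 < r" "i < d"
  shows "proj_mat r u i i \<le> coherence d r u * real r / real d"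
proof -
  have "proj_mat r u i i = (\<Sum>j<d. proj_mat r u i j * proj_mat r u i j)"
    using assms(1) by (simp add: proj_mat_idem)
  also have "\<dots> = (\<Sum>j<d. (proj_mat r u j i)\<^sup>2)"
    by (intro sum.cong refl) (metis power2_eq_square proj_mat_commute)
  also have "\<dots> \<le> Max ((\<lambda>i. (\<Sum>j<d. (proj_mat r u j i)\<^sup>2)) ` {..<d})"
    using assms(3) by (intro Max_ge) auto
  finally show ?thesis using assms by (simp add: coherence_def)
qed

text \<open>The diagonal of the projection sums to its trace \<open>r\<close>, while
  \<open>proj_mat_diag_le\<close> bounds each of the \<open>d\<close> entries.\<close>

lemma coherence_ge_1:
  assumes "orthonormal_family d r u" "0 < r"
  shows "1 \<le> coherence d r u"
proof -
  have "real r = (\<Sum>k<r. \<Sum>i<d. u k i * u k i)"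
    using assms(1) by (simp add: orthonormal_family_def)
  also have "\<dots> = (\<Sum>i<d. proj_mat r u i i)"
    unfolding proj_mat_def by (rule sum.swap)
  also have "\<dots> \<le> (\<Sum>i<d. coherence d r u * real r / real d)"
    using assms by (intro sum_mono proj_mat_diag_le) auto
  \<comment> \<open>For \<open>d = 0\<close> the sum is empty and contradicts \<open>0 < r\<close>;
    otherwise \<open>r\<close> cancels.\<close>
  finally have "real r \<le> (if d = 0 then 0 else coherence d r u * real r)" by simp
  then show ?thesis using assms(2) by (auto split: if_splits)
qed

text \<open>Encodes \<open>P_T X = X - (1 - P_U) X (1 - P_V)\<close>; in this form idempotence
  reduces to that of the two complementary projections.\<close>

definition T_kernel :: "nat \<Rightarrow> (nat \<Rightarrow> nat \<Rightarrow> real) \<Rightarrow> (nat \<Rightarrow> nat \<Rightarrow> real) \<Rightarrow> nat \<times> nat \<Rightarrow> nat \<times> nat \<Rightarrow> real" where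
  "T_kernel r u v = (\<lambda>(a, b) (c, d). of_bool (a = c) * of_bool (b = d)
     - (of_bool (a = c) - proj_mat r u a c) * (of_bool (b = d) - proj_mat r v b d))"

lemma projection_kernel_T_kernel:
  assumes u: "orthonormal_family n1 r u" and v: "orthonormal_family n2 r v"
  shows "projection_kernel ({..<n1} \<times> {..<n2}) (T_kernel r u v)"
proof (unfold_locales, goal_cases)
  case (2 i j)
  then show ?case
    by (auto simp: T_kernel_def proj_mat_commute[of r] split: prod.splits)
next
  case (3 i j)
  obtain a b c d where [simp]: "i = (a, b)" "j = (c, d)" by (metis surj_pair)
  have lt: "a < n1" "b < n2" "c < n1" "d < n2" using 3 by auto
  let ?A = "\<lambda>a e. of_bool (a = e) - proj_mat r u a e"
  let ?B = "\<lambda>b f. of_bool (b = f) - proj_mat r v b f"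
  have "ip ({..<n1} \<times> {..<n2}) (T_kernel r u v i) (T_kernel r u v j)
     = (\<Sum>e<n1. \<Sum>f<n2. (of_bool (a = e) * of_bool (b = f) - ?A a e * ?B b f)
          * (of_bool (c = e) * of_bool (d = f) - ?A c e * ?B d f))"
    by (simp add: ip_def T_kernel_def sum.cartesian_product case_prod_beta)
  \<comment> \<open>Three of the four products contain Kronecker deltas and collapse to single
    entries; the last factors into separate sums over \<open>e\<close> and \<open>f\<close>.\<close>
  also have "\<dots> = (\<Sum>e<n1. \<Sum>f<n2. (if f = b then if e = a then of_bool (a = c) * of_bool (b = d) else 0 else 0)
      - (if f = b then if e = a then ?A c a * ?B d b else 0 else 0)
      - (if f = d then if e = c then ?A a c * ?B b d else 0 else 0) + (?A a e * ?A c e) * (?B b f * ?B d f))"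
    by (intro sum.cong refl) (auto simp: algebra_simps)
  also have "\<dots> = of_bool (a = c) * of_bool (b = d) - ?A c a * ?B d b - ?A a c * ?B b d
      + (\<Sum>e<n1. ?A a e * ?A c e) * (\<Sum>f<n2. ?B b f * ?B d f)"
    unfolding sum_product using lt by (simp add: sum.distrib sum_subtractf)
  also have "\<dots> = T_kernel r u v i j"
    unfolding compl_proj_mat_idem[OF u lt(1,3)] compl_proj_mat_idem[OF v lt(2,4)]
    by (simp add: T_kernel_def proj_mat_commute[of r _ c a] proj_mat_commute[of r _ d b])
  finally show ?case .
qed simp

lemma T_kernel_diag_le:
  "T_kernel r u v (a, b) (a, b) \<le> proj_mat r u a a + proj_mat r v b b"
proof -
  have "0 \<le> proj_mat r u a a * proj_mat r v b b"
    by (simp add: proj_mat_def sum_nonneg)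
  then show ?thesis by (simp add: T_kernel_def algebra_simps)
qed

lemma P_T_eq_ip:
  assumes "a < n1" "b < n2"
  shows "P_T n1 n2 r u v X a b = ip ({..<n1} \<times> {..<n2}) (T_kernel r u v (a, b)) (case_prod X)"
proof -
  have "ip ({..<n1} \<times> {..<n2}) (T_kernel r u v (a, b)) (case_prod X)
     = (\<Sum>c<n1. \<Sum>d<n2. (if d = b then proj_mat r u a c * X c d else 0)
         + (if c = a then proj_mat r v b d * X c d else 0) - proj_mat r u a c * X c d * proj_mat r v b d)"
    unfolding ip_def sum.cartesian_product
    by (intro sum.cong refl) (auto simp: T_kernel_def algebra_simps)
  also have "\<dots> = (\<Sum>c<n1. (\<Sum>d<n2. if d = b then proj_mat r u a c * X c d else 0)
         + (if c = a then (\<Sum>d<n2. proj_mat r v b d * X c d) else 0)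
         - (\<Sum>d<n2. proj_mat r u a c * X c d * proj_mat r v b d))"
    by (intro sum.cong refl) (auto simp: sum.distrib sum_subtractf)
  also have "\<dots> = (\<Sum>c<n1. proj_mat r u a c * X c b) + (\<Sum>d<n2. proj_mat r v b d * X a d)
      - (\<Sum>c<n1. \<Sum>d<n2. proj_mat r u a c * X c d * proj_mat r v b d)"
    using assms by (simp add: sum.distrib sum_subtractf)
  also have "\<dots> = P_T n1 n2 r u v X a b"
    unfolding P_T_def mat_mult_def sum_distrib_right
    using assms(1) by (subst sum.swap) (simp add: proj_mat_commute[of r v b] mult.commute)
  finally show ?thesis by simp
qed

lemma frob_eq_ip: "frob n1 n2 X = sqrt (ip ({..<n1} \<times> {..<n2}) (case_prod X) (case_prod X))"
  unfolding frob_def ip_def sum.cartesian_product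
  by (intro arg_cong[of _ _ sqrt] sum.cong refl) (auto simp: power2_eq_square)

section \<open>Transfer to the sampled operator\<close>

context
  fixes n1 n2 r :: nat and u v :: "nat \<Rightarrow> nat \<Rightarrow> real"
  assumes u: "orthonormal_family n1 r u" and v: "orthonormal_family n2 r v"
begin

interpretation projection_kernel "{..<n1} \<times> {..<n2}" "T_kernel r u v"
  by (rule projection_kernel_T_kernel[OF u v])

text \<open>As \<open>P_T\<close> is idempotent, the difference is
  \<open>P_T (P_Omega - p) P_T\<close>, a frame operator with centered weights.\<close>

lemma P_T_P_Omega_P_T_eq_frame_op:
  assumes "a < n1" "b < n2"
  shows "P_T n1 n2 r u v (P_Omega \<delta> (P_T n1 n2 r u v X)) a b - p * P_T n1 n2 r u v X a b
    = frame_op (\<lambda>i. of_bool (\<delta> i) - p) (case_prod X) (a, b)"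
proof -
  let ?I = "{..<n1} \<times> {..<n2}" and ?G = "T_kernel r u v"
  have j: "(a, b) \<in> ?I" using assms by simp
  have "P_T n1 n2 r u v (P_Omega \<delta> (P_T n1 n2 r u v X)) a b
      = ip ?I (?G (a, b)) (\<lambda>i. of_bool (\<delta> i) * ip ?I (?G i) (case_prod X))"
    unfolding P_T_eq_ip[OF assms]
    by (rule ip_cong) (auto simp: P_Omega_def P_T_eq_ip)
  also have "\<dots> = (\<Sum>i\<in>?I. of_bool (\<delta> i) * ip ?I (?G i) (case_prod X) * ?G i (a, b))"
    unfolding ip_def[of _ "?G (a, b)"] using sym[OF j] by (intro sum.cong refl) (simp add: mult_ac)
  finally have 1: "P_T n1 n2 r u v (P_Omega \<delta> (P_T n1 n2 r u v X)) a b = \<dots>" .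
  \<comment> \<open>\<open>kernel_sum\<close> writes \<open>P_T\<close> as its own square, the frame
    operator with all weights 1.\<close>
  have "P_T n1 n2 r u v X a b
      = (\<Sum>i\<in>?I. ip ?I (?G (a, b)) (?G i) * ip ?I (case_prod X) (?G i))"
    unfolding kernel_sum[OF j] P_T_eq_ip[OF assms] by (rule ip_commute)
  also have "\<dots> = (\<Sum>i\<in>?I. ip ?I (?G i) (case_prod X) * ?G i (a, b))"
    using j by (intro sum.cong refl) (simp add: idem sym[OF j] ip_commute mult.commute)
  finally have 2: "P_T n1 n2 r u v X a b = \<dots>" .
  show ?thesis
    unfolding 1 2 frame_op_def by (simp add: algebra_simps sum_subtractf sum_distrib_left)
qed

lemma op_norm_le_of_frame_op:
  assumes "\<And>z. ip ({..<n1} \<times> {..<n2}) z z \<le> 1 \<Longrightarrow>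
      ip ({..<n1} \<times> {..<n2}) (frame_op (\<lambda>i. of_bool (\<delta> i) - p) z) (frame_op (\<lambda>i. of_bool (\<delta> i) - p) z) \<le> s\<^sup>2"
    and "0 \<le> s"
  shows "op_norm n1 n2 (\<lambda>X. (\<lambda>a b. P_T n1 n2 r u v (P_Omega \<delta> (P_T n1 n2 r u v X)) a b
            - p * P_T n1 n2 r u v X a b)) \<le> s"
  unfolding op_norm_def
proof (rule cSup_least)
  have "frob n1 n2 (\<lambda>_ _. 0) \<le> 1" by (simp add: frob_def)
  then show "{frob n1 n2 (\<lambda>a b. P_T n1 n2 r u v (P_Omega \<delta> (P_T n1 n2 r u v X)) a b
      - p * P_T n1 n2 r u v X a b) |X. frob n1 n2 X \<le> 1} \<noteq> {}" by blast
next
  fix y assume "y \<in> {frob n1 n2 (\<lambda>a b. P_T n1 n2 r u v (P_Omega \<delta> (P_T n1 n2 r u v X)) a b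
      - p * P_T n1 n2 r u v X a b) |X. frob n1 n2 X \<le> 1}"
  then obtain X where X: "frob n1 n2 X \<le> 1" and
    y: "y = frob n1 n2 (\<lambda>a b. P_T n1 n2 r u v (P_Omega \<delta> (P_T n1 n2 r u v X)) a b - p * P_T n1 n2 r u v X a b)"
    by blast
  let ?z = "frame_op (\<lambda>i. of_bool (\<delta> i) - p) (case_prod X)"
  have "y = sqrt (ip ({..<n1} \<times> {..<n2}) ?z ?z)"
    unfolding y frob_eq_ip by (intro arg_cong[of _ _ sqrt] ip_cong) (auto simp: P_T_P_Omega_P_T_eq_frame_op)
  also have "\<dots> \<le> sqrt (s\<^sup>2)"
    using X by (intro real_sqrt_le_mono assms(1)) (simp add: frob_eq_ip)
  finally show "y \<le> s" using assms(2) by simp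
qed

lemma prob_op_norm_le:
  assumes "0 \<le> p" "p \<le> 1" "0 < r" "coherence n1 r u \<le> \<mu>" "coherence n2 r v \<le> \<mu>"
    and "0 < k" "0 < s" "2 * real k * (\<mu> * real r / real n1 + \<mu> * real r / real n2) \<le> \<kappa>"
  shows "1 - ((\<kappa>\<^sup>2 + 4 * p * \<kappa>) / s\<^sup>2) ^ k * (real n1 * real n2)
    \<le> measure_pmf.prob (bernoulli_model n1 n2 p)
       {\<delta>. op_norm n1 n2 (\<lambda>X. (\<lambda>a b. P_T n1 n2 r u v (P_Omega \<delta> (P_T n1 n2 r u v X)) a b
            - p * P_T n1 n2 r u v X a b)) \<le> s}"
proof -
  let ?L = "\<mu> * real r / real n1 + \<mu> * real r / real n2"
  have \<mu>: "0 \<le> \<mu>" using coherence_ge_1[OF u assms(3)] assms(4) by simp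
  have diag: "T_kernel r u v i i \<le> ?L" if "i \<in> {..<n1} \<times> {..<n2}" for i
  proof -
    obtain a b where i: "i = (a, b)" "a < n1" "b < n2" using \<open>i \<in> _\<close> by auto
    have "proj_mat r u a a \<le> \<mu> * real r / real n1"
      using assms(4) by (intro order_trans[OF proj_mat_diag_le[OF u assms(3) i(2)]] divide_right_mono mult_right_mono) auto
    moreover have "proj_mat r v b b \<le> \<mu> * real r / real n2"
      using assms(5) by (intro order_trans[OF proj_mat_diag_le[OF v assms(3) i(3)]] divide_right_mono mult_right_mono) auto
    ultimately show ?thesis using T_kernel_diag_le[of r u v a b] by (simp add: i)
  qed
  have "1 - ((\<kappa>\<^sup>2 + 4 * p * \<kappa>) / s\<^sup>2) ^ k * (real n1 * real n2)
    \<le> measure_pmf.prob (bernoulli_model n1 n2 p)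
       {\<delta>. \<forall>z. ip ({..<n1} \<times> {..<n2}) z z \<le> 1 \<longrightarrow>
         ip ({..<n1} \<times> {..<n2}) (frame_op (\<lambda>i. of_bool (\<delta> i) - p) z) (frame_op (\<lambda>i. of_bool (\<delta> i) - p) z) \<le> s\<^sup>2}"
    using prob_frame_op_norm_le[OF assms(1,2) diag _ assms(8,6,7)] \<mu>
    by (simp add: bernoulli_model_def)
  also have "\<dots> \<le> measure_pmf.prob (bernoulli_model n1 n2 p)
       {\<delta>. op_norm n1 n2 (\<lambda>X. (\<lambda>a b. P_T n1 n2 r u v (P_Omega \<delta> (P_T n1 n2 r u v X)) a b
            - p * P_T n1 n2 r u v X a b)) \<le> s}"
    using assms(7) by (intro measure_pmf.finite_measure_mono) (auto intro!: op_norm_le_of_frame_op)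
  finally show ?thesis .
qed

end

section \<open>Choice of the moment order and the constants\<close>

text \<open>Stated with \<open>p\<close> scaled out. The ratio is at most \<open>exp (- 3)\<close>,
  so its \<open>k\<close>-th power is at most \<open>n powr (- 3 * \<beta>)\<close>; since
  \<open>\<beta> > 1\<close>, this pays for the factor \<open>n^2\<close>.\<close>

lemma moment_tail_le:
  fixes n \<beta> \<rho> t N :: real
  assumes n: "2 \<le> n" and \<beta>: "1 < \<beta>" and \<rho>: "0 < \<rho>" and t: "0 < t" "t < 1" "t\<^sup>2 = 800 * \<rho> * (\<beta> * ln n)"
    and k: "k = nat \<lceil>\<beta> * ln n\<rceil>" and N: "0 \<le> N" "N \<le> n\<^sup>2"
  shows "(((2 * real k * \<rho>)\<^sup>2 + 4 * (2 * real k * \<rho>)) / t\<^sup>2) ^ k * N \<le> n powr (- \<beta>)"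
proof -
  define w where "w = 2 * real k * \<rho>"
  have ln: "2 / 3 \<le> ln n" using ln2_ge_two_thirds n by (meson ln_mono order_trans zero_less_numeral)
  then have \<beta>ln: "2 / 3 \<le> \<beta> * ln n" using mult_mono[of 1 \<beta> "2/3" "ln n"] \<beta> by simp
  have k_lower: "\<beta> * ln n \<le> real k" unfolding k by (rule real_nat_ceiling_ge)
  have "real k \<le> \<beta> * ln n + 1"
    unfolding k using \<beta>ln ceiling_correct[of "\<beta> * ln n"] by simp
  \<comment> \<open>The rounding error 1 is at most \<open>3 / 2 * (\<beta> * ln n)\<close>, by the
    lower bound \<open>2 / 3\<close>.\<close>
  then have k_upper: "2 * real k \<le> 5 * (\<beta> * ln n)" using \<beta>ln by linarith
  have w0: "0 \<le> w" using \<rho> by (simp add: w_def)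
  have "w \<le> 5 * (\<beta> * ln n) * \<rho>" unfolding w_def using k_upper \<rho> by (intro mult_right_mono) auto
  also have "\<dots> = t\<^sup>2 / 160" using t(3) by simp
  finally have w: "w \<le> t\<^sup>2 / 160" .
  moreover have "t\<^sup>2 \<le> 1" using t(1,2) by (simp add: power_le_one)
  ultimately have "w\<^sup>2 \<le> w" using w0 by (simp add: power2_eq_square mult_left_le)
  \<comment> \<open>The left side is at most \<open>5 * w\<close>, and
    \<open>5 / 160 = 1 / 32\<close>.\<close>
  then have "w\<^sup>2 + 4 * w \<le> t\<^sup>2 / 32" using w by linarith
  then have "(w\<^sup>2 + 4 * w) / t\<^sup>2 \<le> 1 / 32" using t(1) by (simp add: field_simps)
  also have "1 / 32 \<le> exp (- 3 :: real)"
  proof -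
    have "exp (3::real) = exp 1 ^ 3" by (simp flip: exp_of_nat_mult)
    also have "\<dots> \<le> 3 ^ 3" by (intro power_mono exp_le) simp
    finally show ?thesis by (simp add: exp_minus field_simps)
  qed
  finally have "((w\<^sup>2 + 4 * w) / t\<^sup>2) ^ k * N \<le> exp (- 3) ^ k * n\<^sup>2"
    using N w0 by (intro mult_mono power_mono) auto
  also have "\<dots> = exp (- 3 * real k + 2 * ln n)"
  proof -
    have "exp (- 3) ^ k = exp (- 3 * real k)"
      by (simp add: exp_of_nat_mult[symmetric] mult.commute)
    moreover have "n\<^sup>2 = exp (2 * ln n)" using n by (simp add: exp_double)
    ultimately show ?thesis by (simp only: exp_add)
  qed
  also have "\<dots> \<le> exp (- \<beta> * ln n)"
  proof -
    have "ln n \<le> \<beta> * ln n" using \<beta> ln by simp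
    then show ?thesis using k_lower by simp
  qed
  also have "\<dots> = n powr (- \<beta>)" using n by (simp add: powr_def)
  finally show ?thesis by (simp add: w_def)
qed

theorem theorem4p1:
  "\<exists>C_R::real. \<forall>(n1::nat) (n2::nat) (r::nat) (m::nat) u v (\<mu>0::real) (\<beta>::real).
     0 < r \<longrightarrow> orthonormal_family n1 r u \<longrightarrow> orthonormal_family n2 r v \<longrightarrow>
     0 < m \<longrightarrow> m \<le> n1 * n2 \<longrightarrow>
     max (coherence n1 r u) (coherence n2 r v) \<le> \<mu>0 \<longrightarrow>
     1 < \<beta> \<longrightarrow>
     (let p = real m / (real n1 * real n2); n = max n1 n2;
          bound = C_R * sqrt (\<mu>0 * real n * real r * (\<beta> * ln (real n)) / real m)
      in bound < 1 \<longrightarrow>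
         measure_pmf.prob (bernoulli_model n1 n2 p)
           {\<delta>. inverse p * op_norm n1 n2
                 (\<lambda>X. (\<lambda>a b. P_T n1 n2 r u v (P_Omega \<delta> (P_T n1 n2 r u v X)) a b
                             - p * P_T n1 n2 r u v X a b)) \<le> bound}
         \<ge> 1 - 3 * real n powr (- \<beta>))"
\<comment> \<open>The witness satisfies \<open>40^2 = 2 * 800\<close>, matching the 800 of
  \<open>moment_tail_le\<close> with a \<open>\<rho>\<close> that carries a factor 2.\<close>
proof (rule exI[of _ 40], intro allI impI, unfold Let_def, intro impI, goal_cases)
  case (1 n1 n2 r m u v \<mu>0 \<beta>)
  define p where "p = real m / (real n1 * real n2)"
  define n where "n = max n1 n2"
  define t where "t = 40 * sqrt (\<mu>0 * real n * real r * (\<beta> * ln (real n)) / real m)"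
  have pos: "0 < n1" "0 < n2" using 1(4,5) by (auto intro: Nat.gr0I)
  have t1: "t < 1" using 1 by (simp add: t_def n_def)
  let ?dev = "\<lambda>\<delta>. op_norm n1 n2 (\<lambda>X. (\<lambda>a b. P_T n1 n2 r u v (P_Omega \<delta> (P_T n1 n2 r u v X)) a b
                             - p * P_T n1 n2 r u v X a b))"
  have "1 - 3 * real n powr (- \<beta>)
    \<le> measure_pmf.prob (bernoulli_model n1 n2 p) {\<delta>. inverse p * ?dev \<delta> \<le> t}"
  \<comment> \<open>For \<open>n = 1\<close> the logarithm vanishes, but
    \<open>n powr (- \<beta>)\<close> is 1 and the claimed lower bound is negative.\<close>
  proof (cases "n = 1")
    case True
    then have "1 - 3 * real n powr (- \<beta>) \<le> 0" by simp
    then show ?thesis using measure_nonneg order_trans by blast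
  next
    case False
    then have n2: "2 \<le> real n" using pos by (simp add: n_def max_def split: if_splits)
    have p: "0 < p" "p \<le> 1"
      using pos 1(4,5) by (simp_all add: p_def divide_le_eq flip: of_nat_mult)
    have \<mu>: "1 \<le> \<mu>0" using coherence_ge_1[OF 1(2,1)] 1(6) by simp
    \<comment> \<open>The factor 2 comes from \<open>n1 + n2 \<le> 2 * n\<close>; the coherence
      bound on the diagonal of the kernel is then at most \<open>p * \<rho>\<close>.\<close>
    define \<rho> where "\<rho> = 2 * \<mu>0 * real r * real n / real m"
    define k where "k = nat \<lceil>\<beta> * ln (real n)\<rceil>"
    have \<rho>: "0 < \<rho>" using \<mu> 1(1,4) n2 by (simp add: \<rho>_def)
    have \<beta>ln: "0 < \<beta> * ln (real n)" using n2 1(7) by simp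
    have k0: "0 < k" using \<beta>ln by (simp add: k_def)
    have arg: "\<mu>0 * real n * real r * (\<beta> * ln (real n)) / real m = \<rho> / 2 * (\<beta> * ln (real n))"
      by (simp add: \<rho>_def)
    have t0: "0 < t" unfolding t_def arg using \<rho> \<beta>ln by simp
    have t2: "t\<^sup>2 = 800 * \<rho> * (\<beta> * ln (real n))"
      unfolding t_def arg using \<rho> \<beta>ln by (simp add: power_mult_distrib)
    have "\<mu>0 * real r / real n1 + \<mu>0 * real r / real n2 = p * (\<mu>0 * real r * (real n1 + real n2) / real m)"
      using pos 1(4) by (simp add: p_def field_simps)
    also have "\<dots> \<le> p * (\<mu>0 * real r * (2 * real n) / real m)"
      using \<mu> p by (intro mult_left_mono divide_right_mono) (auto simp: n_def)
    also have "\<dots> = p * \<rho>" by (simp add: \<rho>_def)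
    finally have "2 * real k * (\<mu>0 * real r / real n1 + \<mu>0 * real r / real n2) \<le> 2 * real k * (p * \<rho>)"
      by (intro mult_left_mono) auto
    then have tail: "1 - (((2 * real k * (p * \<rho>))\<^sup>2 + 4 * p * (2 * real k * (p * \<rho>))) / (p * t)\<^sup>2) ^ k * (real n1 * real n2)
      \<le> measure_pmf.prob (bernoulli_model n1 n2 p) {\<delta>. ?dev \<delta> \<le> p * t}"
      using 1 p t0 k0 by (intro prob_op_norm_le) auto
    \<comment> \<open>With \<open>\<kappa> = 2 * k * (p * \<rho>)\<close> and threshold
      \<open>p * t\<close>, numerator and denominator both carry \<open>p^2\<close>, which
      cancels.\<close>
    have scale: "((2 * real k * (p * \<rho>))\<^sup>2 + 4 * p * (2 * real k * (p * \<rho>))) / (p * t)\<^sup>2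
       = ((2 * real k * \<rho>)\<^sup>2 + 4 * (2 * real k * \<rho>)) / t\<^sup>2"
      using p(1) t0 by (simp add: field_simps power2_eq_square)
    have "real n1 * real n2 \<le> (real n)\<^sup>2"
      unfolding power2_eq_square by (intro mult_mono) (auto simp: n_def)
    then have "(((2 * real k * \<rho>)\<^sup>2 + 4 * (2 * real k * \<rho>)) / t\<^sup>2) ^ k * (real n1 * real n2) \<le> real n powr (- \<beta>)"
      using n2 1(7) \<rho> t0 t1 t2 by (intro moment_tail_le) (auto simp: k_def)
    moreover have "0 \<le> real n powr (- \<beta>)" by simp
    ultimately have "1 - 3 * real n powr (- \<beta>) \<le> measure_pmf.prob (bernoulli_model n1 n2 p) {\<delta>. ?dev \<delta> \<le> p * t}"
      using tail unfolding scale by linarith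
    also have "{\<delta>. ?dev \<delta> \<le> p * t} = {\<delta>. inverse p * ?dev \<delta> \<le> t}"
      using p(1) by (simp add: field_simps)
    finally show ?thesis .
  qed
  then show ?case by (simp only: p_def n_def t_def)
qed

end
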